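(* Let $N$ be the number of applicants and let $\alpha,\beta,\gamma\in[0,1]$. Put $H_{k,N}=\sum_{j=k}^{N-1}\frac1j$. The solution of the dynamic programming equation $$V(k)=\max\Big\{(\alpha+\beta)\frac kN-\beta,\ \sum_{j=k+1}^N\frac{k}{j(j-1)}\big(\gamma+V(j)\big)-\gamma\Big\},\qquad k=1,2,\dots,N,\qquad V(N)=\alpha,$$ is $$V(k)=\begin{cases}\dfrac{k^\star-1}{N}\Big((\alpha+\beta)H_{k^\star,N}+\beta-\gamma\Big)-\beta, & k=1,2,\dots,k^\star-1,\\[2mm] (\alpha+\beta)\dfrac kN-\beta, & k=k^\star,\dots,N,\end{cases}$$ where $k^\star$ is the integer $k$ for which $$H_{k-1,N}\ \ge\ \frac{\alpha+\gamma}{\alpha+\beta}\ >\ H_{k,N}.$$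
   Context: Background: $N$ distinct rankable applicants appear one by one in uniformly random order, and only relative ranks are observed. A candidate is an applicant that is the best among those seen so far. The decision maker can make one choice, without recall. Choosing the overall best applicant pays $\alpha$, choosing another applicant pays $-\beta$, and ending without a choice pays $-\gamma$. $V(k)$ is the maximum expected payoff when the $k$-th applicant is a candidate and no choice has been made before; $(\alpha+\beta)\frac kN-\beta$ is the expected reward for choosing the candidate at time $k$, and $\frac{k}{j(j-1)}$ is the probability that the next candidate after time $k$ appears at time $j$.
   Formalization: In the first branch H_{k*,N} is corrected to H_{k*-1,N} (as printed it fails for N=2, α=1, β=γ=0: V(1)=1/2, not 0); existence of k* is claimed only if α+β>0 and α+γ>0, since otherwise there is none; H_{0,N} is read as +∞. *)

theory Defs
  imports Complex_Main
begin

definition H :: "nat \<Rightarrow> nat \<Rightarrow> real" where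
  "H k N = (\<Sum>j=k..<N. 1 / real j)"

(* Expected reward for choosing the candidate at time k *)
definition stop_reward :: "nat \<Rightarrow> real \<Rightarrow> real \<Rightarrow> nat \<Rightarrow> real" where
  "stop_reward N \<alpha> \<beta> k = (\<alpha> + \<beta>) * (real k / real N) - \<beta>"

(* Expected reward for passing at time k, where V j is the value of facing a candidate at time j.
   If there is no further candidate, the payoff is -\<gamma>. *)
definition continuation ::
  "nat \<Rightarrow> real \<Rightarrow> (nat \<Rightarrow> real) \<Rightarrow> nat \<Rightarrow> real" where
  "continuation N \<gamma> V k =
     (\<Sum>j=k+1..N. real k / (real j * (real j - 1)) * (\<gamma> + V j)) - \<gamma>"

(* Only the values V 1, ..., V N are constrained. *)
definition DP_solution ::
  "nat \<Rightarrow> real \<Rightarrow> real \<Rightarrow> real \<Rightarrow> (nat \<Rightarrow> real) \<Rightarrow> bool" where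
  "DP_solution N \<alpha> \<beta> \<gamma> V \<longleftrightarrow>
     (\<forall>k\<in>{1..N}. V k = max (stop_reward N \<alpha> \<beta> k) (continuation N \<gamma> V k)) \<and> V N = \<alpha>"

(* For k = 1 the left-hand condition involves H 0 N, whose first summand is 1/0; it is read as
   +infinity, so the condition holds (HOL's convention 1 / 0 = 0 would give the wrong meaning). *)
definition is_threshold ::
  "nat \<Rightarrow> real \<Rightarrow> real \<Rightarrow> real \<Rightarrow> nat \<Rightarrow> bool" where
  "is_threshold N \<alpha> \<beta> \<gamma> k \<longleftrightarrow>
     k \<in> {1..N} \<and>
     (k = 1 \<or> H (k - 1) N \<ge> (\<alpha> + \<gamma>) / (\<alpha> + \<beta>)) \<and>
     (\<alpha> + \<gamma>) / (\<alpha> + \<beta>) > H k N"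

(* The first branch is the continuation value at time ks - 1, which contains H (ks - 1) N.
   With H ks N in its place, as the formula is sometimes printed, it does not solve the
   equation: for N = 2, \<alpha> = 1, \<beta> = \<gamma> = 0 we have ks = 2 and V 1 = 1/2, but H 2 2 = 0. *)
definition threshold_value ::
  "nat \<Rightarrow> real \<Rightarrow> real \<Rightarrow> real \<Rightarrow> nat \<Rightarrow> nat \<Rightarrow> real" where
  "threshold_value N \<alpha> \<beta> \<gamma> ks k =
     (if k < ks
      then (real ks - 1) / real N * ((\<alpha> + \<beta>) * H (ks - 1) N + \<beta> - \<gamma>) - \<beta>
      else (\<alpha> + \<beta>) * (real k / real N) - \<beta>)"

end

(* The continuation value at k is the convex combination of V (k+1) and the continuation value at
   k+1 with weights 1/(k+1) and k/(k+1).  Solving this recursion with V the reward for stopping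
   gives a closed form whose comparison with that reward is exactly H k N against
   (alpha + gamma) / (alpha + beta).  Below the threshold V equals the continuation value, so the
   recursion makes both constant, while the reward for stopping decreases as k does.  The dynamic
   programming equation determines V by backward recursion, which gives uniqueness. *)
theory Submission
  imports Defs
begin

lemma H_antimono:
  assumes "k \<le> l"
  shows "H l N \<le> H k N"
  unfolding H_def using assms by (intro sum_mono2) auto

lemma H_Suc:
  assumes "k < N"
  shows "H k N = 1 / real k + H (Suc k) N"
  unfolding H_def using assms by (simp add: sum.atLeast_Suc_lessThan)

lemma H_self [simp]: "H N N = 0"
  by (simp add: H_def)

lemma H_nonneg: "0 \<le> H k N"
  unfolding H_def by (intro sum_nonneg) auto

lemma continuation_self [simp]: "continuation N \<gamma> V N = - \<gamma>"
  by (simp add: continuation_def)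

lemma continuation_cong:
  assumes "\<And>j. k < j \<Longrightarrow> j \<le> N \<Longrightarrow> V j = W j"
  shows "continuation N \<gamma> V k = continuation N \<gamma> W k"
  unfolding continuation_def using assms by (auto intro!: sum.cong)

text \<open>The weights \<open>k / (j * (j - 1))\<close> depend on \<open>k\<close> only through the
  numerator, so apart from the term at \<open>Suc k\<close> both sums are multiples of one common
  tail, \<open>S\<close> in the proof.\<close>

lemma continuation_step:
  assumes "1 \<le> k" "k < N"
  shows "continuation N \<gamma> V k =
    (V (Suc k) + real k * continuation N \<gamma> V (Suc k)) / real (Suc k)"
proof -
  define S where "S = (\<Sum>j=Suc (Suc k)..N. (\<gamma> + V j) / (real j * (real j - 1)))"
  have factor: "(\<Sum>j=m..N. c / (real j * (real j - 1)) * (\<gamma> + V j)) =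
      c * (\<Sum>j=m..N. (\<gamma> + V j) / (real j * (real j - 1)))" for c m
    by (simp add: sum_distrib_left)
  have "continuation N \<gamma> V k =
      (\<gamma> + V (Suc k)) / real (Suc k) + real k * S - \<gamma>"
    using assms unfolding continuation_def factor S_def
    by (simp add: sum.atLeast_Suc_atMost distrib_left add_divide_distrib)
  moreover have "continuation N \<gamma> V (Suc k) = real (Suc k) * S - \<gamma>"
    unfolding continuation_def factor S_def by simp
  ultimately show ?thesis
    by (simp only:) (simp add: field_simps)
qed

text \<open>Backward induction along \<open>continuation_step\<close>. At \<open>k = N\<close> the
  harmonic sum is empty and the formula reduces to \<open>- \<gamma>\<close>.\<close>

lemma continuation_stop_reward:
  assumes "1 \<le> k" "k \<le> N"
  shows "continuation N \<gamma> (stop_reward N \<alpha> \<beta>) k =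
    real k / real N * ((\<alpha> + \<beta>) * H k N + \<beta> - \<gamma>) - \<beta>"
  using assms(2,1)
proof (induction rule: inc_induct)
  case base
  then show ?case by simp
next
  case (step k)
  then have "continuation N \<gamma> (stop_reward N \<alpha> \<beta>) k =
      (stop_reward N \<alpha> \<beta> (Suc k) + real k *
        (real (Suc k) / real N * ((\<alpha> + \<beta>) * H (Suc k) N + \<beta> - \<gamma>) - \<beta>)) / real (Suc k)"
    by (simp add: continuation_step)
  also have "\<dots> = real k / real N * ((\<alpha> + \<beta>) * H k N + \<beta> - \<gamma>) - \<beta>"
  proof -
    \<comment> \<open>The only property of \<open>1 / real k\<close> that the identity needs;
      \<open>algebra\<close> treats reciprocals as opaque.\<close>
    have "real k * (1 / real k) = 1"
      using step.prems by simp
    then have "stop_reward N \<alpha> \<beta> (Suc k) + real k *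
        (real (Suc k) / real N * ((\<alpha> + \<beta>) * H (Suc k) N + \<beta> - \<gamma>) - \<beta>) =
      real (Suc k) * (real k / real N *
        ((\<alpha> + \<beta>) * (1 / real k + H (Suc k) N) + \<beta> - \<gamma>) - \<beta>)"
      unfolding stop_reward_def of_nat_Suc divide_inverse by algebra
    then show ?thesis
      using step.hyps by (simp add: H_Suc del: of_nat_Suc)
  qed
  finally show ?case .
qed

text \<open>Averaging two equal values returns that value, so the constant spreads downwards from
  \<open>m\<close>. Only \<open>V\<close> at times after \<open>k\<close> enters, so nothing is
  assumed about \<open>V k\<close> itself.\<close>

lemma continuation_constant:
  assumes "1 \<le> k" "k \<le> m" "m \<le> N"
    and "\<And>j. k < j \<Longrightarrow> j \<le> m \<Longrightarrow> V j = continuation N \<gamma> V m"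
  shows "continuation N \<gamma> V k = continuation N \<gamma> V m"
  using assms(2,1,4)
proof (induction rule: inc_induct)
  case base
  then show ?case by simp
next
  case (step k)
  then have "continuation N \<gamma> V (Suc k) = continuation N \<gamma> V m"
    and "V (Suc k) = continuation N \<gamma> V m"
    by auto
  with step.hyps step.prems assms(3) show ?case
    by (simp add: continuation_step field_simps)
qed

lemma ex1_is_threshold:
  assumes "N \<ge> 1" "\<alpha> + \<beta> > 0" "\<alpha> + \<gamma> > 0"
  shows "\<exists>!k. is_threshold N \<alpha> \<beta> \<gamma> k"
proof -
  define r where "r = (\<alpha> + \<gamma>) / (\<alpha> + \<beta>)"
  \<comment> \<open>\<open>N\<close> is a witness, because \<open>H N N = 0\<close> and
    \<open>r\<close> is positive. Minimality gives the left-hand condition, and starting the search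
    at 1 produces the exceptional case \<open>k = 1\<close>.\<close>
  define k where "k = (LEAST k. 1 \<le> k \<and> H k N < r)"
  have N: "1 \<le> N \<and> H N N < r"
    using assms by (simp add: r_def)
  have k: "1 \<le> k \<and> H k N < r"
    unfolding k_def by (rule LeastI) (rule N)
  have "k \<le> N"
    unfolding k_def by (rule Least_le) (rule N)
  moreover have "k = 1 \<or> H (k - 1) N \<ge> r"
    using not_less_Least[of "k - 1" "\<lambda>k. 1 \<le> k \<and> H k N < r"] k
    unfolding k_def[symmetric] by fastforce
  ultimately have ex: "is_threshold N \<alpha> \<beta> \<gamma> k"
    using k by (simp add: is_threshold_def r_def)
  \<comment> \<open>Two thresholds \<open>i < j\<close> would give
    \<open>r \<le> H (j - 1) N \<le> H i N < r\<close>; the escape \<open>j = 1\<close> is excluded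
    by \<open>1 \<le> i\<close>.\<close>
  have "\<not> i < j" if "is_threshold N \<alpha> \<beta> \<gamma> i" "is_threshold N \<alpha> \<beta> \<gamma> j" for i j
  proof
    assume "i < j"
    then have "H (j - 1) N \<le> H i N"
      by (intro H_antimono) simp
    with that \<open>i < j\<close> show False
      by (auto simp: is_threshold_def)
  qed
  with ex show ?thesis
    by (metis linorder_neqE_nat)
qed

lemma stop_reward_mono:
  assumes "0 \<le> \<alpha> + \<beta>" "k \<le> l"
  shows "stop_reward N \<alpha> \<beta> k \<le> stop_reward N \<alpha> \<beta> l"
  unfolding stop_reward_def using assms
  by (intro diff_right_mono mult_left_mono divide_right_mono) auto

text \<open>Since \<open>real k / real N\<close> is positive, the sign of the last factor decides
  between stopping and passing.\<close>

lemma stop_reward_minus_continuation: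
  assumes "1 \<le> k" "k \<le> N"
  shows "stop_reward N \<alpha> \<beta> k - continuation N \<gamma> (stop_reward N \<alpha> \<beta>) k =
    real k / real N * ((\<alpha> + \<gamma>) - H k N * (\<alpha> + \<beta>))"
  unfolding continuation_stop_reward[OF assms] stop_reward_def
  by algebra

lemma continuation_le_stop_reward:
  assumes "1 \<le> k" "k \<le> N" "0 < \<alpha> + \<beta>" "H k N \<le> (\<alpha> + \<gamma>) / (\<alpha> + \<beta>)"
  shows "continuation N \<gamma> (stop_reward N \<alpha> \<beta>) k \<le> stop_reward N \<alpha> \<beta> k"
proof -
  have "0 \<le> real k / real N * ((\<alpha> + \<gamma>) - H k N * (\<alpha> + \<beta>))"
    using assms by (intro mult_nonneg_nonneg) (simp_all add: pos_le_divide_eq)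
  with stop_reward_minus_continuation[OF assms(1,2)] show ?thesis
    by (metis diff_ge_0_iff_ge)
qed

lemma stop_reward_le_continuation:
  assumes "1 \<le> k" "k \<le> N" "0 < \<alpha> + \<beta>" "(\<alpha> + \<gamma>) / (\<alpha> + \<beta>) \<le> H k N"
  shows "stop_reward N \<alpha> \<beta> k \<le> continuation N \<gamma> (stop_reward N \<alpha> \<beta>) k"
proof -
  have "real k / real N * ((\<alpha> + \<gamma>) - H k N * (\<alpha> + \<beta>)) \<le> 0"
    using assms by (intro mult_nonneg_nonpos) (simp_all add: pos_divide_le_eq)
  with stop_reward_minus_continuation[OF assms(1,2)] show ?thesis
    by (metis diff_le_0_iff_le)
qed

lemma threshold_value_fixpoint:
  assumes "0 \<le> \<alpha>" "0 \<le> \<beta>" "0 \<le> \<gamma>"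
    and ks: "is_threshold N \<alpha> \<beta> \<gamma> ks"
    and k: "k \<in> {1..N}"
  shows "threshold_value N \<alpha> \<beta> \<gamma> ks k =
    max (stop_reward N \<alpha> \<beta> k) (continuation N \<gamma> (threshold_value N \<alpha> \<beta> \<gamma> ks) k)"
    (is "?W k = max (?s k) (?c k)")
proof -
  \<comment> \<open>A positive ratio rules out \<open>\<alpha> + \<beta> = 0\<close>, where division
    by zero would make it 0.\<close>
  have "(\<alpha> + \<gamma>) / (\<alpha> + \<beta>) > 0"
    using ks H_nonneg[of ks N] unfolding is_threshold_def by linarith
  then have pos: "0 < \<alpha> + \<beta>"
    using assms(1-3) by (auto simp: zero_less_divide_iff)
  have above: "?W j = ?s j" if "ks \<le> j" for j
    using that by (simp add: threshold_value_def stop_reward_def)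
  \<comment> \<open>Continuing at \<open>j\<close> involves only times after \<open>j\<close>, so
    this reaches down to \<open>j = ks - 1\<close>, whose value is the constant of the first
    branch.\<close>
  have c: "?c j = continuation N \<gamma> ?s j" if "ks \<le> Suc j" for j
    using that by (intro continuation_cong above) simp
  show ?thesis
  proof (cases "ks \<le> k")
    case True
    then have "H k N \<le> (\<alpha> + \<gamma>) / (\<alpha> + \<beta>)"
      using ks H_antimono[OF True, of N] by (simp add: is_threshold_def)
    then have "?c k \<le> ?s k"
      using True k pos by (simp add: c continuation_le_stop_reward)
    with above[OF True] show ?thesis by simp
  next
    case False
    let ?m = "ks - 1"
    have m: "1 \<le> ?m" "?m \<le> N" "k \<le> ?m"
      using False k ks by (auto simp: is_threshold_def)
    have below: "?W j = ?c ?m" if "j < ks" for j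
      using that m
      by (subst c) (simp_all add: continuation_stop_reward threshold_value_def of_nat_diff)
    have "?c k = ?c ?m"
      using m k by (intro continuation_constant below) auto
    \<comment> \<open>Here \<open>ks > 1\<close>, so the threshold inequality at
      \<open>ks - 1\<close> is available. The chain
      \<open>?s k \<le> ?s ?m \<le> ?c ?m = ?c k\<close> then identifies the maximum.\<close>
    moreover have "?s ?m \<le> ?c ?m"
      using ks m pos
      by (subst c) (auto simp: is_threshold_def intro: stop_reward_le_continuation)
    moreover have "?s k \<le> ?s ?m"
      using pos m by (intro stop_reward_mono) auto
    ultimately show ?thesis
      using below[of k] False by simp
  qed
qed

text \<open>The two positivity conditions say that the ratio is positive; otherwise no threshold
  exists, as \<open>H k N\<close> is nonnegative.\<close>

theorem theorem2p1:
  fixes N :: nat and \<alpha> \<beta> \<gamma> :: real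
  assumes "N \<ge> 1"
    and "\<alpha> \<in> {0..1}" and "\<beta> \<in> {0..1}" and "\<gamma> \<in> {0..1}"
  shows "(\<alpha> + \<beta> > 0 \<and> \<alpha> + \<gamma> > 0 \<longrightarrow> (\<exists>!k. is_threshold N \<alpha> \<beta> \<gamma> k)) \<and>
    (\<forall>ks. is_threshold N \<alpha> \<beta> \<gamma> ks \<longrightarrow>
      (\<forall>V :: nat \<Rightarrow> real. DP_solution N \<alpha> \<beta> \<gamma> V \<longleftrightarrow>
        (\<forall>k\<in>{1..N}. V k = threshold_value N \<alpha> \<beta> \<gamma> ks k)))"
proof (intro conjI impI allI)
  assume "\<alpha> + \<beta> > 0 \<and> \<alpha> + \<gamma> > 0"
  then show "\<exists>!k. is_threshold N \<alpha> \<beta> \<gamma> k"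
    using assms(1) ex1_is_threshold by blast
next
  fix ks and V :: "nat \<Rightarrow> real"
  assume ks: "is_threshold N \<alpha> \<beta> \<gamma> ks"
  let ?W = "threshold_value N \<alpha> \<beta> \<gamma> ks"
  have fix_W: "?W k = max (stop_reward N \<alpha> \<beta> k) (continuation N \<gamma> ?W k)"
    if "k \<in> {1..N}" for k
    using threshold_value_fixpoint[OF _ _ _ ks that] assms by simp
  show "DP_solution N \<alpha> \<beta> \<gamma> V \<longleftrightarrow> (\<forall>k\<in>{1..N}. V k = ?W k)"
  proof
    assume V: "DP_solution N \<alpha> \<beta> \<gamma> V"
    have "V k = ?W k" if "k \<in> {1..N}" for k
      using that
    \<comment> \<open>Backward recursion: agreement at all later times fixes the continuation value
      at \<open>k\<close>, and the equation then fixes \<open>V k\<close>.\<close>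
    proof (induction "N - k" arbitrary: k rule: less_induct)
      case less
      then have "continuation N \<gamma> V k = continuation N \<gamma> ?W k"
        by (intro continuation_cong) simp
      with V less.prems fix_W show ?case
        by (simp add: DP_solution_def)
    qed
    then show "\<forall>k\<in>{1..N}. V k = ?W k" by blast
  next
    assume eq: "\<forall>k\<in>{1..N}. V k = ?W k"
    have "continuation N \<gamma> V k = continuation N \<gamma> ?W k" if "k \<in> {1..N}" for k
      using eq that by (intro continuation_cong) simp
    moreover have "?W N = \<alpha>"
      using ks by (auto simp: threshold_value_def is_threshold_def)
    ultimately show "DP_solution N \<alpha> \<beta> \<gamma> V"
      using eq fix_W assms(1) by (simp add: DP_solution_def)
  qed
qed

end
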